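(* Let $A,B \subseteq 2^{\mathbb{N}}$. Then $A$ and $B$ are Borel separable (that is, there is a Borel set $S \subseteq 2^{\mathbb{N}}$ with $A \subseteq S$ and $S \cap B = \emptyset$) if and only if Player I has a winning strategy in the Borel cut-and-choose game $\mathrm{BCG}_{A,B}$.
   Context: $2^{\mathbb{N}}$ is the Cantor space of infinite binary strings $x = x_0x_1\cdots$ with its usual product topology. The Borel cut-and-choose game $\mathrm{BCG}_{A,B}$ is played between Player I (Cut) and Player II (Choose) as follows. Start with $A^{(0)} = A$ and $B^{(0)} = B$. In the $n$-th round ($n \in \mathbb{N}$), Player I partitions either $A^{(n)}$ into countably many pieces $A^{(n)}_0, A^{(n)}_1, \dots$, or $B^{(n)}$ into countably many pieces $B^{(n)}_0, B^{(n)}_1, \dots$ (here a partition into countably many pieces means a sequence of pairwise disjoint, possibly empty, sets whose union is the given set). If Player I partitioned $A^{(n)}$, Player II chooses some $j \in \mathbb{N}$ and one sets $A^{(n+1)} = A^{(n)}_j$, $B^{(n+1)} = B^{(n)}$. If Player I partitioned $B^{(n)}$, Player II chooses some $k \in \mathbb{N}$ and one sets $A^{(n+1)} = A^{(n)}$, $B^{(n+1)} = B^{(n)}_k$. Player I wins the run if there exist $i,n \in \mathbb{N}$ such that $x_i \neq y_i$ for all $(x,y) \in A^{(n)} \times B^{(n)}$; otherwise Player II wins. *)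

theory Defs
  imports "HOL-Analysis.Analysis"
begin

(* The type class topology on nat => bool is the product of the discrete topology on bool,
   so its Borel sets are "sets borel". *)
type_synonym cantor = "nat \<Rightarrow> bool"

definition borel_separable :: "cantor set \<Rightarrow> cantor set \<Rightarrow> bool" where
  "borel_separable A B \<longleftrightarrow> (\<exists>S \<in> sets (borel :: cantor measure). A \<subseteq> S \<and> S \<inter> B = {})"

(* Pieces may be empty and need not be Borel. *)
definition countable_partition :: "cantor set \<Rightarrow> (nat \<Rightarrow> cantor set) \<Rightarrow> bool" where
  "countable_partition X P \<longleftrightarrow> disjoint_family P \<and> (\<Union>k. P k) = X"

datatype cut = CutA "nat \<Rightarrow> cantor set" | CutB "nat \<Rightarrow> cantor set"

fun legal_cut :: "cantor set \<times> cantor set \<Rightarrow> cut \<Rightarrow> bool" where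
  "legal_cut (X, Y) (CutA P) \<longleftrightarrow> countable_partition X P"
| "legal_cut (X, Y) (CutB P) \<longleftrightarrow> countable_partition Y P"

fun choose_piece :: "cantor set \<times> cantor set \<Rightarrow> cut \<Rightarrow> nat \<Rightarrow> cantor set \<times> cantor set" where
  "choose_piece (X, Y) (CutA P) j = (P j, Y)"
| "choose_piece (X, Y) (CutB P) k = (X, P k)"

(* The pair (A^(n), B^(n)) when Player I plays the cuts m and Player II the choices c. *)
primrec position ::
  "cantor set \<Rightarrow> cantor set \<Rightarrow> (nat \<Rightarrow> cut) \<Rightarrow> (nat \<Rightarrow> nat) \<Rightarrow> nat \<Rightarrow> cantor set \<times> cantor set" where
  "position A B m c 0 = (A, B)"
| "position A B m c (Suc n) = choose_piece (position A B m c n) (m n) (c n)"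

definition legal_run :: "cantor set \<Rightarrow> cantor set \<Rightarrow> (nat \<Rightarrow> cut) \<Rightarrow> (nat \<Rightarrow> nat) \<Rightarrow> bool" where
  "legal_run A B m c \<longleftrightarrow> (\<forall>n. legal_cut (position A B m c n) (m n))"

definition player_I_wins_run :: "cantor set \<Rightarrow> cantor set \<Rightarrow> (nat \<Rightarrow> cut) \<Rightarrow> (nat \<Rightarrow> nat) \<Rightarrow> bool" where
  "player_I_wins_run A B m c \<longleftrightarrow>
     (\<exists>i n. \<forall>(x, y) \<in> fst (position A B m c n) \<times> snd (position A B m c n). x i \<noteq> y i)"

(* A strategy for Player I maps the finite list of Player II's previous choices, in order of
   play, to the next cut; Player I's own previous cuts are determined by these choices. *)
type_synonym strategy_I = "nat list \<Rightarrow> cut"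

definition cuts_of :: "strategy_I \<Rightarrow> (nat \<Rightarrow> nat) \<Rightarrow> nat \<Rightarrow> cut" where
  "cuts_of \<sigma> c n = \<sigma> (map c [0..<n])"

definition winning_strategy_I :: "cantor set \<Rightarrow> cantor set \<Rightarrow> strategy_I \<Rightarrow> bool" where
  "winning_strategy_I A B \<sigma> \<longleftrightarrow>
     (\<forall>c. legal_run A B (cuts_of \<sigma> c) c \<and> player_I_wins_run A B (cuts_of \<sigma> c) c)"

end

theory Submission
  imports Defs
begin

text \<open>
  Call a position won if it lies in the least class of positions that contains every position in
  which some coordinate already distinguishes the two sets, and that contains every position from
  which some cut leads into the class whatever piece is chosen. This class is the link between the
  two sides of the equivalence.

  Won positions are exactly those from which Player I has a winning strategy. A derivation that a
  position is won is a well-founded tree, and following the tree is a winning strategy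
  (\<open>won_imp_winning_strategy\<close>). Conversely, from a position that is not won, Player II can always
  choose a piece that is again not won, and so never reaches a position distinguished by a
  coordinate (\<open>winning_strategy_imp_won\<close>).

  Won positions are also exactly the Borel separable pairs. Along the tree, a separating Borel set
  is assembled from the separating sets of the pieces: a cut of the first set corresponds to a
  countable union, a cut of the second one to a countable intersection, and a distinguishing
  coordinate to a subbasic clopen set (\<open>won_imp_borel_separable\<close>). Conversely, the sets \<open>S\<close> such
  that \<open>(S, - S)\<close> is won form a \<open>\<sigma>\<close>-algebra that contains these clopen sets (\<open>won_borel\<close>), and
  winning is inherited by smaller pairs (\<open>won_mono\<close>).
\<close>

section \<open>Won positions\<close>

inductive won :: "cantor set \<times> cantor set \<Rightarrow> bool" where
  decided: "\<forall>(x, y) \<in> fst p \<times> snd p. x i \<noteq> y i \<Longrightarrow> won p"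
| cut: "legal_cut p m \<Longrightarrow> \<forall>j. won (choose_piece p m j) \<Longrightarrow> won p"

lemma countable_partition_Int:
  assumes "countable_partition X P" and "X' \<subseteq> X"
  shows "countable_partition X' (\<lambda>k. P k \<inter> X')"
  using assms unfolding countable_partition_def disjoint_family_on_def by blast

text \<open>Player I can copy the cuts made from the larger position, restricting the pieces.\<close>

lemma won_mono:
  assumes "won p" and "fst q \<subseteq> fst p" and "snd q \<subseteq> snd p"
  shows "won q"
  using assms
proof (induction p arbitrary: q rule: won.induct)
  case (decided p i)
  then have "\<forall>(x, y) \<in> fst q \<times> snd q. x i \<noteq> y i" by blast
  then show ?case by (rule won.decided)
next
  case (cut p m)
  obtain X Y where p: "p = (X, Y)" by fastforce
  obtain X' Y' where q: "q = (X', Y')" by fastforce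
  have sub: "X' \<subseteq> X" "Y' \<subseteq> Y" using cut.prems p q by auto
  show ?case
  proof (cases m)
    case (CutA P)
    show ?thesis
    proof (rule won.cut)
      show "legal_cut q (CutA (\<lambda>k. P k \<inter> X'))"
        using cut.hyps p q CutA sub countable_partition_Int by simp
      show "\<forall>j. won (choose_piece q (CutA (\<lambda>k. P k \<inter> X')) j)"
        using cut.IH p q CutA sub by (simp, blast)
    qed
  next
    case (CutB P)
    show ?thesis
    proof (rule won.cut)
      show "legal_cut q (CutB (\<lambda>k. P k \<inter> Y'))"
        using cut.hyps p q CutB sub countable_partition_Int by simp
      show "\<forall>j. won (choose_piece q (CutB (\<lambda>k. P k \<inter> Y')) j)"
        using cut.IH p q CutB sub by (simp, blast)
    qed
  qed
qed

text \<open>The rules treat the two sets of a position alike: exchanging the sets exchanges the two kinds of cut.\<close>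

lemma won_swap:
  assumes "won p"
  shows "won (snd p, fst p)"
  using assms
proof (induction p rule: won.induct)
  case (decided p i)
  then have "\<forall>(x, y) \<in> fst (snd p, fst p) \<times> snd (snd p, fst p). x i \<noteq> y i" by fastforce
  then show ?case by (rule won.decided)
next
  case (cut p m)
  obtain X Y where p: "p = (X, Y)" by fastforce
  show ?case
  proof (cases m)
    case (CutA P)
    show ?thesis
      by (rule won.cut[where m = "CutB P"]) (use cut p CutA in auto)
  next
    case (CutB P)
    show ?thesis
      by (rule won.cut[where m = "CutA P"]) (use cut p CutB in auto)
  qed
qed

section \<open>Won positions and Borel separation\<close>

text \<open>
  The pieces of a countable union can be made disjoint before Player I cuts along them; each
  piece is then separated from the complement of the union already by one of the sets.
\<close>

lemma won_UN:
  fixes S :: "nat \<Rightarrow> cantor set"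
  assumes "\<And>n. won (S n, - S n)"
  shows "won (\<Union>n. S n, - (\<Union>n. S n))"
proof (rule won.cut)
  show "legal_cut (\<Union>n. S n, - (\<Union>n. S n)) (CutA (disjointed S))"
    by (simp add: countable_partition_def disjoint_family_disjointed UN_disjointed_eq)
  show "\<forall>j. won (choose_piece (\<Union>n. S n, - (\<Union>n. S n)) (CutA (disjointed S)) j)"
  proof
    fix j
    show "won (choose_piece (\<Union>n. S n, - (\<Union>n. S n)) (CutA (disjointed S)) j)"
      by (rule won_mono[OF assms[of j]]) (use disjointed_subset[of S j] in auto)
  qed
qed

instance bool :: second_countable_topology
proof
  show "\<exists>B :: bool set set. countable B \<and> open = generate_topology B"
    by (intro exI[of _ "range lessThan \<union> range greaterThan"])
      (auto simp: open_bool_def)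
qed

text \<open>
  Since \<open>bool\<close> has a countable base, the Borel sets of the Cantor space are generated by conditions
  on single coordinates, and such a condition and its negation are distinguished by that
  coordinate. Taking the complement of a set exchanges the two sets of the position.
\<close>

lemma won_borel:
  assumes "S \<in> sets (borel :: cantor measure)"
  shows "won (S, - S)"
proof -
  have "S \<in> sets (Pi\<^sub>M UNIV (\<lambda>_ :: nat. borel :: bool measure))"
    using assms by (simp add: sets_PiM_equal_borel)
  then have "S \<in> sigma_sets UNIV {{f. f i \<in> U} | i (U :: bool set). U \<in> sets borel}"
    by (simp add: sets_PiM_single)
  then show ?thesis
  proof (induction rule: sigma_sets.induct)
    case (Basic T)
    then obtain i U where "T = {f. f i \<in> U}" by blast
    then show ?case by (intro won.decided[where i = i]) auto
  next
    case Empty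
    show ?case by (rule won.decided) simp
  next
    case (Compl T)
    then show ?case using won_swap by (fastforce simp: Compl_eq_Diff_UNIV[symmetric])
  next
    case (Union T)
    then show ?case by (intro won_UN)
  qed
qed

lemma borel_separable_imp_won:
  assumes "borel_separable A B"
  shows "won (A, B)"
proof -
  obtain S where "S \<in> sets (borel :: cantor measure)" "A \<subseteq> S" "S \<inter> B = {}"
    using assms unfolding borel_separable_def by blast
  then show ?thesis using won_mono[OF won_borel, of S "(A, B)"] by auto
qed

lemma borel_coordinate: "{x :: cantor. x i = b} \<in> sets borel"
proof -
  have "(\<lambda>x :: cantor. x i) \<in> borel_measurable borel"
    by (intro borel_measurable_continuous_onI continuous_on_product_coordinates)
  from measurable_sets[OF this, of "{b}"] show ?thesis
    by (simp add: vimage_def)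
qed

lemma won_imp_borel_separable:
  assumes "won p"
  shows "borel_separable (fst p) (snd p)"
  using assms
proof (induction p rule: won.induct)
  case (decided p i)
  show ?case
  proof (cases "fst p = {} \<or> snd p = {}")
    case True
    moreover have "{} \<in> sets (borel :: cantor measure)" "UNIV \<in> sets (borel :: cantor measure)"
      by auto
    ultimately show ?thesis unfolding borel_separable_def by blast
  next
    case False
    then obtain y where "y \<in> snd p" by blast
    with decided have first: "x i = (\<not> y i)" if "x \<in> fst p" for x
      using that by blast
    obtain x where "x \<in> fst p" using False by blast
    \<comment> \<open>Bits have only two values: whatever differs at \<open>i\<close> from \<open>x\<close> agrees there with \<open>y\<close>.\<close>
    with decided first have "z i = y i" if "z \<in> snd p" for z
      using that by blast
    with first have "fst p \<subseteq> {x. x i = (\<not> y i)}" "{x. x i = (\<not> y i)} \<inter> snd p = {}"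
      by auto
    then show ?thesis
      unfolding borel_separable_def
      using borel_coordinate[of i "\<not> y i"] by (intro bexI[of _ "{x. x i = (\<not> y i)}"] conjI)
  qed
next
  case (cut p m)
  obtain X Y where p: "p = (X, Y)" by fastforce
  show ?case
  proof (cases m)
    case (CutA P)
    have "\<forall>j. \<exists>S \<in> sets borel. P j \<subseteq> S \<and> S \<inter> Y = {}"
      using cut.IH p CutA by (auto simp: borel_separable_def)
    then obtain S where S: "\<And>j. S j \<in> sets borel" "\<And>j. P j \<subseteq> S j" "\<And>j. S j \<inter> Y = {}"
      by metis
    have "(\<Union>j. S j) \<in> sets borel" using S(1) by blast
    moreover have "X \<subseteq> (\<Union>j. S j)"
      using cut.hyps p CutA S(2) by (force simp: countable_partition_def)
    moreover have "(\<Union>j. S j) \<inter> Y = {}" using S(3) by blast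
    ultimately show ?thesis using p unfolding borel_separable_def by auto
  next
    case (CutB P)
    have "\<forall>j. \<exists>S \<in> sets borel. X \<subseteq> S \<and> S \<inter> P j = {}"
      using cut.IH p CutB by (auto simp: borel_separable_def)
    then obtain S where S: "\<And>j. S j \<in> sets borel" "\<And>j. X \<subseteq> S j" "\<And>j. S j \<inter> P j = {}"
      by metis
    have "(\<Inter>j. S j) \<in> sets borel" using S(1) by blast
    moreover have "X \<subseteq> (\<Inter>j. S j)" using S(2) by blast
    moreover have "(\<Inter>j. S j) \<inter> Y = {}"
      using cut.hyps p CutB S(3) by (force simp: countable_partition_def)
    ultimately show ?thesis using p unfolding borel_separable_def by auto
  qed
qed

section \<open>Won positions and winning strategies\<close>

text \<open>
  The definition of a run adds rounds at its end; strategies are composed by adding a round at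
  the beginning.
\<close>

lemma position_Suc_shift:
  "position A B m c (Suc n) =
    position (fst (choose_piece (A, B) (m 0) (c 0))) (snd (choose_piece (A, B) (m 0) (c 0)))
      (\<lambda>k. m (Suc k)) (\<lambda>k. c (Suc k)) n"
  by (induction n) auto

lemma cuts_of_Suc: "cuts_of \<sigma> c (Suc n) = cuts_of (\<lambda>l. \<sigma> (c 0 # l)) (\<lambda>k. c (Suc k)) n"
  unfolding cuts_of_def by (simp only: map_upt_Suc)

text \<open>
  A decided position is won outright, but the run goes on: Player I must keep making legal cuts,
  and offers the whole current first set as piece \<open>0\<close> next to empty pieces. A choice other than
  \<open>0\<close> empties that set for good.
\<close>

lemma decided_imp_winning_strategy:
  assumes "\<forall>(x, y) \<in> A \<times> B. x i \<noteq> y i"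
  shows "\<exists>\<sigma>. winning_strategy_I A B \<sigma>"
proof -
  define \<sigma> where "\<sigma> l = CutA (\<lambda>j. if j = 0 \<and> set l \<subseteq> {0} then A else {})" for l :: "nat list"
  have pos: "position A B (cuts_of \<sigma> c) c n = (if c ` {..<n} \<subseteq> {0} then A else {}, B)" for c n
    by (induction n) (auto simp: cuts_of_def \<sigma>_def lessThan_Suc atLeast0LessThan)
  have "legal_run A B (cuts_of \<sigma> c) c" for c
    unfolding legal_run_def pos
    by (auto simp: cuts_of_def \<sigma>_def countable_partition_def disjoint_family_on_def
        atLeast0LessThan split: if_splits)
  moreover have "player_I_wins_run A B (cuts_of \<sigma> c) c" for c
    unfolding player_I_wins_run_def
    using assms by (intro exI[of _ i] exI[of _ "0 :: nat"]) simp
  ultimately show ?thesis unfolding winning_strategy_I_def by blast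
qed

lemma cut_imp_winning_strategy:
  assumes legal: "legal_cut (A, B) m"
    and win: "\<And>j. winning_strategy_I (fst (choose_piece (A, B) m j))
                (snd (choose_piece (A, B) m j)) (\<tau> j)"
  shows "winning_strategy_I A B (\<lambda>l. case l of [] \<Rightarrow> m | j # l' \<Rightarrow> \<tau> j l')"
    (is "winning_strategy_I A B ?\<sigma>")
  unfolding winning_strategy_I_def
proof (intro allI conjI)
  fix c :: "nat \<Rightarrow> nat"
  let ?p = "choose_piece (A, B) m (c 0)"
  let ?c = "\<lambda>k. c (Suc k)"
  have first: "cuts_of ?\<sigma> c 0 = m" by (simp add: cuts_of_def)
  have rest: "cuts_of ?\<sigma> c (Suc n) = cuts_of (\<tau> (c 0)) ?c n" for n
    by (simp add: cuts_of_Suc)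
  have pos: "position A B (cuts_of ?\<sigma> c) c (Suc n) =
      position (fst ?p) (snd ?p) (cuts_of (\<tau> (c 0)) ?c) ?c n" for n
    by (simp only: position_Suc_shift first rest)
  have sub: "legal_run (fst ?p) (snd ?p) (cuts_of (\<tau> (c 0)) ?c) ?c"
    "player_I_wins_run (fst ?p) (snd ?p) (cuts_of (\<tau> (c 0)) ?c) ?c"
    using win[of "c 0"] unfolding winning_strategy_I_def by blast+
  show "legal_run A B (cuts_of ?\<sigma> c) c"
    unfolding legal_run_def
  proof
    fix n
    show "legal_cut (position A B (cuts_of ?\<sigma> c) c n) (cuts_of ?\<sigma> c n)"
    proof (cases n)
      case 0
      then show ?thesis using legal first by simp
    next
      case (Suc k)
      then show ?thesis using sub(1) unfolding legal_run_def Suc pos rest by blast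
    qed
  qed
  show "player_I_wins_run A B (cuts_of ?\<sigma> c) c"
    using sub(2) unfolding player_I_wins_run_def pos[symmetric] by blast
qed

lemma won_imp_winning_strategy:
  assumes "won p"
  shows "\<exists>\<sigma>. winning_strategy_I (fst p) (snd p) \<sigma>"
  using assms
proof (induction p rule: won.induct)
  case (decided p i)
  then show ?case by (rule decided_imp_winning_strategy)
next
  case (cut p m)
  then obtain \<tau> where
    "\<And>j. winning_strategy_I (fst (choose_piece p m j)) (snd (choose_piece p m j)) (\<tau> j)"
    by metis
  with cut_imp_winning_strategy[of "fst p" "snd p" m \<tau>] cut.hyps show ?case by auto
qed

lemma cuts_of_cong:
  assumes "\<And>k. k < n \<Longrightarrow> c k = d k"
  shows "cuts_of \<sigma> c n = cuts_of \<sigma> d n"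
proof -
  have "map c [0..<n] = map d [0..<n]" using assms by simp
  then show ?thesis by (simp only: cuts_of_def)
qed

lemma position_cong:
  assumes "\<And>k. k < n \<Longrightarrow> c k = d k"
  shows "position A B (cuts_of \<sigma> c) c n = position A B (cuts_of \<sigma> d) d n"
  using assms
proof (induction n)
  case (Suc n)
  then show ?case using cuts_of_cong[of n c d \<sigma>] by simp
qed simp

text \<open>
  Against any legal strategy Player II can stay outside the won positions, since a cut all of
  whose pieces are won can only be made in a won position. A run that stays outside never reaches
  a decided position.
\<close>

lemma winning_strategy_imp_won:
  assumes "winning_strategy_I A B \<sigma>"
  shows "won (A, B)"
proof (rule ccontr)
  assume not_won: "\<not> won (A, B)"
  let ?pos = "\<lambda>c. position A B (cuts_of \<sigma> c) c"
  \<comment> \<open>The choices are found round by round; stage \<open>n\<close> holds a whole sequence of choices, of which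
    only the first \<open>n\<close> are final.\<close>
  have "\<exists>f. \<forall>n. \<not> won (?pos (f n) n) \<and> (\<forall>k<n. f (Suc n) k = f n k)"
  proof (rule dependent_nat_choice)
    show "\<exists>c. \<not> won (?pos c 0)" using not_won by simp
  next
    fix c n
    assume stay: "\<not> won (?pos c n)"
    have "legal_cut (?pos c n) (cuts_of \<sigma> c n)"
      using assms unfolding winning_strategy_I_def legal_run_def by blast
    with stay obtain j where j: "\<not> won (choose_piece (?pos c n) (cuts_of \<sigma> c n) j)"
      using won.cut by blast
    have "?pos (c(n := j)) n = ?pos c n" by (rule position_cong) simp
    moreover have "cuts_of \<sigma> (c(n := j)) n = cuts_of \<sigma> c n" by (rule cuts_of_cong) simp
    ultimately have "\<not> won (?pos (c(n := j)) (Suc n))" using j by simp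
    then show "\<exists>d. \<not> won (?pos d (Suc n)) \<and> (\<forall>k<n. d k = c k)"
      by (intro exI[of _ "c(n := j)"]) simp
  qed
  then obtain f where stay: "\<And>n. \<not> won (?pos (f n) n)"
    and agree: "\<And>n k. k < n \<Longrightarrow> f (Suc n) k = f n k" by blast
  define c where "c k = f (Suc k) k" for k
  have "f n k = c k" if "Suc k \<le> n" for n k
    using that
  proof (induction n rule: dec_induct)
    case base
    show ?case by (simp add: c_def)
  next
    case (step n)
    then show ?case using agree[of k n] by simp
  qed
  then have "?pos c n = ?pos (f n) n" for n by (intro position_cong) simp
  with stay have "\<not> won (?pos c n)" for n by simp
  then have "\<not> player_I_wins_run A B (cuts_of \<sigma> c) c"
    unfolding player_I_wins_run_def using won.decided by blast
  then show False using assms unfolding winning_strategy_I_def by blast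
qed

theorem theorem7p4:
  fixes A B :: "(nat \<Rightarrow> bool) set"
  shows "borel_separable A B \<longleftrightarrow> (\<exists>\<sigma>. winning_strategy_I A B \<sigma>)"
proof
  assume "borel_separable A B"
  from won_imp_winning_strategy[OF borel_separable_imp_won[OF this]]
  show "\<exists>\<sigma>. winning_strategy_I A B \<sigma>" by simp
next
  assume "\<exists>\<sigma>. winning_strategy_I A B \<sigma>"
  then have "won (A, B)" using winning_strategy_imp_won by blast
  from won_imp_borel_separable[OF this] show "borel_separable A B" by simp
qed

end
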